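(* Let $D$ be a finite set and $R\subsetneq S\subseteq D^2$. Then either $\mathrm{NRD}(R\mid S,n)=O_D(n)$, or there exists an integer $k\ge 2$ such that $\mathrm{NRD}(R\mid S,n)=\Theta_D(\mathrm{NRD}(C^*_{2k}\mid C_{2k},n))$.
   Context: $C_{2k}\subseteq\{0,\dots,k-1\}^2$ consists of the pairs $(a,b)$ with $(a,b)\in\{(0,0),(k-1,k-1)\}$ or $|a-b|=1$, and $C^*_{2k}=C_{2k}\setminus\{(0,0)\}$. For $R\subseteq S\subseteq D^r$, an instance $(X,Y)$ ($X$ finite, $Y\subseteq X^r$) is a non-redundant instance of $\mathrm{CSP}(R\mid S)$ if for every $y\in Y$ there is $\sigma:X\to D$ with $\sigma(y')\in R$ for all $y'\in Y\setminus\{y\}$ and $\sigma(y)\in S\setminus R$; $\mathrm{NRD}(R\mid S,n)$ is the maximum $|Y|$ over such instances with $|X|=n$. Subscript $D$ means implied constants depend on $D$. *)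

theory Defs
  imports Complex_Main "HOL-Library.FuncSet"
begin

(* Binary relations on a domain D are subsets of D \<times> D. An assignment \<sigma> acts on a
   constraint (x, x') componentwise, i.e. as map_prod \<sigma> \<sigma>. *)
definition nonredundant_instance ::
  "'d set \<Rightarrow> ('d \<times> 'd) set \<Rightarrow> ('d \<times> 'd) set \<Rightarrow> 'x set \<Rightarrow> ('x \<times> 'x) set \<Rightarrow> bool" where
  "nonredundant_instance D R S X Y \<longleftrightarrow>
     finite X \<and> Y \<subseteq> X \<times> X \<and>
     (\<forall>y\<in>Y. \<exists>\<sigma>\<in>X \<rightarrow> D.
        (\<forall>y'\<in>Y - {y}. map_prod \<sigma> \<sigma> y' \<in> R) \<and> map_prod \<sigma> \<sigma> y \<in> S - R)"

(* Variables are taken to be natural numbers, which loses no generality since X is finite.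
   The maximum is over a finite set (card Y \<le> n\<^sup>2) that contains 0 (from Y = {}). *)
definition NRD :: "'d set \<Rightarrow> ('d \<times> 'd) set \<Rightarrow> ('d \<times> 'd) set \<Rightarrow> nat \<Rightarrow> nat" where
  "NRD D R S n =
     Max {card Y | (X :: nat set) Y. card X = n \<and> nonredundant_instance D R S X Y}"

(* C2 k is the relation C_{2k}: as a bipartite graph it is a cycle with 2k edges. *)
definition C2 :: "nat \<Rightarrow> (nat \<times> nat) set" where
  "C2 k = {(a, b). a < k \<and> b < k \<and>
             ((a, b) \<in> {(0, 0), (k - 1, k - 1)} \<or> \<bar>int a - int b\<bar> = 1)}"

definition C2_star :: "nat \<Rightarrow> (nat \<times> nat) set" where
  "C2_star k = C2 k - {(0, 0)}"

end

(* View a binary relation as a bipartite graph on two copies of the domain. Let 2k - 1 be the least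
   length of a path in R joining the ends of some edge (a, b) of S - R. Such a path together with
   (a, b) is an image of the cycle C_{2k}. Conversely, for every edge (a, b) of S - R, the distance
   from a in R, capped at 2k - 1, folds R onto the path C*_{2k} and sends (a, b) to the missing
   edge (0, 0). These maps act differently on the two sides of the graph, so the variables are first
   split into two parts keeping a quarter of the constraints. If no such path exists, then the
   bipartite graph of a non-redundant instance is a forest. *)
theory Submission
  imports Defs
begin

section \<open>The maximum \<open>NRD\<close> and a linear lower bound\<close>

lemma NRD_finite_nonempty:
  fixes n :: nat
  shows "finite {card Y | (X :: nat set) Y. card X = n \<and> nonredundant_instance D R S X Y}"
    and "{card Y | (X :: nat set) Y. card X = n \<and> nonredundant_instance D R S X Y} \<noteq> {}"
proof -
  have "card Y \<le> n * n" if "card X = n" "nonredundant_instance D R S X Y" for X :: "nat set" and Y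
  proof -
    have "finite X" "Y \<subseteq> X \<times> X"
      using that by (auto simp: nonredundant_instance_def)
    then show ?thesis
      using that(1) by (metis card_cartesian_product card_mono finite_cartesian_product)
  qed
  then have "{card Y | (X :: nat set) Y. card X = n \<and> nonredundant_instance D R S X Y} \<subseteq> {..n * n}"
    by auto
  then show "finite {card Y | (X :: nat set) Y. card X = n \<and> nonredundant_instance D R S X Y}"
    by (rule finite_subset) simp
  have "nonredundant_instance D R S {..<n} {}"
    by (simp add: nonredundant_instance_def)
  then show "{card Y | (X :: nat set) Y. card X = n \<and> nonredundant_instance D R S X Y} \<noteq> {}"
    using card_lessThan[of n] by blast
qed

lemma card_le_NRD:
  fixes X :: "nat set"
  assumes "nonredundant_instance D R S X Y" "card X = n"
  shows "card Y \<le> NRD D R S n"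
  unfolding NRD_def using assms by (intro Max_ge NRD_finite_nonempty) auto

lemma NRD_attained:
  obtains X :: "nat set" and Y
  where "card X = n" "nonredundant_instance D R S X Y" "card Y = NRD D R S n"
  using Max_in[OF NRD_finite_nonempty[of n D R S]] unfolding NRD_def by auto

text \<open>A matching of \<open>n div 2\<close> disjoint constraints is non-redundant: one of them
  goes to an edge of \<open>S - R\<close>, all others to one fixed edge of \<open>R\<close>. The
  worst case for the factor 3 is \<open>n = 3\<close>. The bound serves to absorb the loops
  \<open>(x, x)\<close> of an instance, which no cut can keep.\<close>

lemma linear_le_NRD:
  assumes "2 \<le> n" "R \<noteq> {}" "R \<subset> S" "S \<subseteq> D \<times> D"
  shows "n \<le> 3 * NRD D R S n"
proof -
  obtain c d where cd: "(c, d) \<in> R" using assms by auto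
  obtain a b where ab: "(a, b) \<in> S - R" using assms by auto
  define m where "m = n div 2"
  define Y where "Y = (\<lambda>i. (i, m + i)) ` {..<m}"
  have "\<exists>\<sigma>\<in>{..<n} \<rightarrow> D. (\<forall>y'\<in>Y - {y}. map_prod \<sigma> \<sigma> y' \<in> R) \<and> map_prod \<sigma> \<sigma> y \<in> S - R"
    if "y \<in> Y" for y
  proof -
    from that obtain i where i: "i < m" "y = (i, m + i)" unfolding Y_def by blast
    define \<sigma> where
      "\<sigma> x = (if x = i then a else if x = m + i then b else if x < m then c else d)" for x
    have "a \<in> D" "b \<in> D" "c \<in> D" "d \<in> D" using ab cd assms by auto
    then have "\<sigma> \<in> {..<n} \<rightarrow> D" by (simp add: \<sigma>_def)
    moreover have "map_prod \<sigma> \<sigma> y \<in> S - R" using i ab by (auto simp: \<sigma>_def)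
    moreover have "\<forall>y'\<in>Y - {y}. map_prod \<sigma> \<sigma> y' \<in> R" using i cd by (auto simp: \<sigma>_def Y_def split: if_splits)
    ultimately show ?thesis by blast
  qed
  moreover have "Y \<subseteq> {..<n} \<times> {..<n}" by (auto simp: Y_def m_def)
  ultimately have "nonredundant_instance D R S {..<n} Y"
    by (simp add: nonredundant_instance_def)
  then have "card Y \<le> NRD D R S n" by (rule card_le_NRD) simp
  moreover have "card Y = m" unfolding Y_def by (subst card_image) (auto simp: inj_on_def)
  ultimately show ?thesis using \<open>2 \<le> n\<close> by (simp add: m_def)
qed

section \<open>Large cuts and directed cuts\<close>

text \<open>Greedy argument: vertices are placed one at a time, each on the side that cuts at least
  half of its edges to the vertices already placed.\<close>

lemma exists_large_cut:
  assumes "finite X" "Y \<subseteq> X \<times> X" "irrefl Y"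
  shows "\<exists>L\<subseteq>X. card Y \<le> 2 * card {(x, y) \<in> Y. x \<in> L \<longleftrightarrow> y \<notin> L}"
  using assms
proof (induction X arbitrary: Y rule: finite_induct)
  case empty
  then show ?case by auto
next
  case (insert v X)
  define Z where "Z = Y \<inter> (X \<times> X)"
  have "finite Y" using insert.hyps(1) insert.prems(1)
    by (meson finite.insertI finite_SigmaI finite_subset)
  obtain L where L: "L \<subseteq> X" "card Z \<le> 2 * card {(x, y) \<in> Z. x \<in> L \<longleftrightarrow> y \<notin> L}"
    using insert.IH[of Z] insert.prems by (auto simp: Z_def irrefl_def)
  define cut where "cut M U = {(x, y) \<in> U. x \<in> M \<longleftrightarrow> y \<notin> M}" for M :: "'a set" and U
  have split: "card (cut M Y) = card (cut M Z) + card (cut M (Y - Z))" for M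
  proof -
    have "cut M Y = cut M Z \<union> cut M (Y - Z)" by (auto simp: cut_def Z_def)
    moreover have "cut M Z \<inter> cut M (Y - Z) = {}" by (auto simp: cut_def)
    moreover have "finite (cut M U)" if "U \<subseteq> Y" for U
      using \<open>finite Y\<close> that by (auto simp: cut_def intro: finite_subset)
    ultimately show ?thesis
      by (metis Diff_subset Int_lower1 Z_def card_Un_disjoint)
  qed
  have same: "cut (insert v L) Z = cut L Z"
    using \<open>v \<notin> X\<close> by (auto simp: cut_def Z_def)
  \<comment> \<open>The edges in \<open>Y - Z\<close> are those at \<open>v\<close>. None is a loop,
    so each is cut by one of the two placements of \<open>v\<close>; the edges in \<open>Z\<close>
    do not notice the choice.\<close>
  have "Y - Z \<subseteq> cut L (Y - Z) \<union> cut (insert v L) (Y - Z)"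
    using insert.prems L(1) \<open>v \<notin> X\<close> by (auto simp: cut_def Z_def irrefl_def)
  then have "card (Y - Z) \<le> card (cut L (Y - Z) \<union> cut (insert v L) (Y - Z))"
    by (rule card_mono[rotated]) (use \<open>finite Y\<close> in \<open>auto simp: cut_def intro: finite_subset\<close>)
  also have "\<dots> \<le> card (cut L (Y - Z)) + card (cut (insert v L) (Y - Z))" by (rule card_Un_le)
  finally have "card (Y - Z) \<le> 2 * card (cut L (Y - Z)) \<or>
      card (Y - Z) \<le> 2 * card (cut (insert v L) (Y - Z))" by linarith
  moreover have "card Y = card Z + card (Y - Z)"
    using \<open>finite Y\<close> by (metis Int_lower1 Z_def add.commute card_Diff_subset card_mono
        diff_add finite_subset)
  moreover have "card Z \<le> 2 * card (cut L Z)" using L(2) by (simp add: cut_def)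
  ultimately have "card Y \<le> 2 * card (cut L Y) \<or> card Y \<le> 2 * card (cut (insert v L) Y)"
    using split[of L] split[of "insert v L"] same by auto
  then show ?case using L(1) unfolding cut_def by blast
qed

text \<open>The more frequent direction keeps half of the cut edges. If it runs from
  \<open>- L\<close> to \<open>L\<close>, the complement serves as the witness.\<close>

lemma exists_large_directed_cut:
  assumes "finite X" "Y \<subseteq> X \<times> X" "irrefl Y"
  shows "\<exists>L. card Y \<le> 4 * card (Y \<inter> (L \<times> (- L)))"
proof -
  obtain L where L: "card Y \<le> 2 * card {(x, y) \<in> Y. x \<in> L \<longleftrightarrow> y \<notin> L}"
    using exists_large_cut[OF assms] by auto
  have "{(x, y) \<in> Y. x \<in> L \<longleftrightarrow> y \<notin> L} = Y \<inter> (L \<times> (- L)) \<union> Y \<inter> ((- L) \<times> (- (- L)))"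
    by auto
  then have "card {(x, y) \<in> Y. x \<in> L \<longleftrightarrow> y \<notin> L}
      \<le> card (Y \<inter> (L \<times> (- L))) + card (Y \<inter> ((- L) \<times> (- (- L))))"
    by (metis card_Un_le)
  then have "card Y \<le> 4 * card (Y \<inter> (L \<times> (- L))) \<or> card Y \<le> 4 * card (Y \<inter> ((- L) \<times> (- (- L))))"
    using L by linarith
  then show ?thesis by blast
qed

section \<open>Transfer of instances between relations\<close>

text \<open>Witnesses are composed with \<open>f\<close> on \<open>L\<close> and with
  \<open>g\<close> off \<open>L\<close>, so the constraints from \<open>L\<close> to
  \<open>- L\<close> stay non-redundant. The maps may depend on \<open>(a, b)\<close> because every
  constraint has its own witness. The constant 7 is 4 for the directed cut plus 3 for the
  loops.\<close>

lemma NRD_le_if_maps: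
  assumes "2 \<le> n" "R' \<noteq> {}" "R' \<subset> S'" "S' \<subseteq> D' \<times> D'"
    and maps: "\<And>a b. (a, b) \<in> S - R \<Longrightarrow> \<exists>f\<in>D \<rightarrow> D'. \<exists>g\<in>D \<rightarrow> D'.
      (\<forall>(x, y)\<in>R. (f x, g y) \<in> R') \<and> (f a, g b) \<in> S' - R'"
  shows "NRD D R S n \<le> 7 * NRD D' R' S' n"
proof -
  obtain X :: "nat set" and Y
    where XY: "card X = n" "nonredundant_instance D R S X Y" "card Y = NRD D R S n"
    by (rule NRD_attained)
  have X: "finite X" "Y \<subseteq> X \<times> X" using XY by (auto simp: nonredundant_instance_def)
  then have "finite Y" by (meson finite_SigmaI finite_subset)
  obtain L where L: "card (Y - Id) \<le> 4 * card ((Y - Id) \<inter> (L \<times> (- L)))"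
    using exists_large_directed_cut[of X "Y - Id"] X by (auto simp: irrefl_def)
  define Z where "Z = (Y - Id) \<inter> (L \<times> (- L))"
  have "\<exists>\<tau>\<in>X \<rightarrow> D'. (\<forall>z'\<in>Z - {z}. map_prod \<tau> \<tau> z' \<in> R') \<and> map_prod \<tau> \<tau> z \<in> S' - R'"
    if "z \<in> Z" for z
  proof -
    have "z \<in> Y" using that by (simp add: Z_def)
    then obtain \<sigma> where \<sigma>: "\<sigma> \<in> X \<rightarrow> D" "\<forall>y'\<in>Y - {z}. map_prod \<sigma> \<sigma> y' \<in> R"
      "map_prod \<sigma> \<sigma> z \<in> S - R"
      using XY(2) unfolding nonredundant_instance_def by blast
    obtain f g where fg: "f \<in> D \<rightarrow> D'" "g \<in> D \<rightarrow> D'" "\<forall>(x, y)\<in>R. (f x, g y) \<in> R'"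
      "(f (\<sigma> (fst z)), g (\<sigma> (snd z))) \<in> S' - R'"
      using maps[of "\<sigma> (fst z)" "\<sigma> (snd z)"] \<sigma>(3) by (cases z) auto
    define \<tau> where "\<tau> x = (if x \<in> L then f (\<sigma> x) else g (\<sigma> x))" for x
    have "\<tau> \<in> X \<rightarrow> D'" using \<sigma>(1) fg(1,2) by (simp add: \<tau>_def Pi_iff)
    moreover have "map_prod \<tau> \<tau> z \<in> S' - R'" using fg(4) that by (auto simp: \<tau>_def Z_def)
    moreover have "map_prod \<tau> \<tau> z' \<in> R'" if "z' \<in> Z - {z}" for z'
    proof -
      have "map_prod \<sigma> \<sigma> z' \<in> R" using that \<sigma>(2) by (auto simp: Z_def)
      then show ?thesis using fg(3) that by (cases z') (auto simp: \<tau>_def Z_def)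
    qed
    ultimately show ?thesis by blast
  qed
  then have "nonredundant_instance D' R' S' X Z"
    using X by (auto simp: nonredundant_instance_def Z_def)
  then have "card Z \<le> NRD D' R' S' n" using XY(1) by (rule card_le_NRD)
  moreover have "card (Y \<inter> Id) \<le> n"
  proof -
    have "Y \<inter> Id \<subseteq> (\<lambda>x. (x, x)) ` X" using X by auto
    then show ?thesis using X XY(1) by (metis surj_card_le)
  qed
  moreover have "n \<le> 3 * NRD D' R' S' n" using assms by (intro linear_le_NRD)
  moreover have "card Y \<le> card (Y - Id) + card (Y \<inter> Id)"
    by (metis Un_Diff_Int card_Un_le)
  ultimately show ?thesis using L XY(3) by (simp add: Z_def)
qed

section \<open>Forests and the linear case\<close>

text \<open>The last hypothesis says that no edge lies on a cycle. Edges are added one by one, and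
  each merges two components.\<close>

lemma card_forest_le:
  fixes V :: "'a set"
  assumes "finite V" "finite E" "E \<subseteq> V \<times> V"
    and "\<And>u v. (u, v) \<in> E \<Longrightarrow> (u, v) \<notin> ((E - {(u, v)}) \<union> (E - {(u, v)})\<inverse>)\<^sup>*"
  shows "card E \<le> card V"
proof -
  \<comment> \<open>The map \<open>c\<close> labels components: equal labels force connectedness,
    hence the ends of a new edge carry different labels.\<close>
  have "\<exists>c :: 'a \<Rightarrow> 'a. card (c ` V) + card E \<le> card V \<and> (\<forall>x\<in>V. \<forall>y\<in>V. c x = c y \<longrightarrow> (x, y) \<in> (E \<union> E\<inverse>)\<^sup>*)"
    using assms(2-)
  proof (induction E rule: finite_induct)
    case empty
    show ?case by (rule exI[of _ "\<lambda>x. x"]) auto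
  next
    case (insert e E)
    obtain u v where e: "e = (u, v)" by force
    let ?W = "\<lambda>F. (F \<union> F\<inverse>)\<^sup>*"
    have mono: "?W F \<subseteq> ?W G" if "F \<subseteq> G" for F G :: "('a \<times> 'a) set"
      using that by (intro rtrancl_mono) auto
    have "(a, b) \<notin> ?W (E - {(a, b)})" if "(a, b) \<in> E" for a b
      using insert.prems(2)[of a b] that mono[of "E - {(a, b)}" "insert e E - {(a, b)}"] by blast
    then obtain c :: "'a \<Rightarrow> 'a" where c: "card (c ` V) + card E \<le> card V"
      "\<And>x y. x \<in> V \<Longrightarrow> y \<in> V \<Longrightarrow> c x = c y \<Longrightarrow> (x, y) \<in> ?W E"
      using insert.IH insert.prems(1) by blast
    have uv: "u \<in> V" "v \<in> V" using insert.prems e by auto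
    have "insert e E - {(u, v)} = E" using e insert.hyps by blast
    then have "(u, v) \<notin> ?W E" using insert.prems(2)[of u v] e by (metis insertI1)
    then have ne: "c u \<noteq> c v" using c(2)[OF uv] by blast
    \<comment> \<open>Merging the component of \<open>v\<close> into that of \<open>u\<close> frees
      the label \<open>c v\<close>, which pays for the new edge.\<close>
    define c' where "c' x = (if c x = c v then c u else c x)" for x
    have "c' x \<in> c ` V - {c v}" if "x \<in> V" for x using uv ne that by (simp add: c'_def)
    then have "c' ` V \<subseteq> c ` V - {c v}" by (rule image_subsetI)
    then have "card (c' ` V) \<le> card (c ` V - {c v})"
      using \<open>finite V\<close> by (intro card_mono) auto
    also have "\<dots> < card (c ` V)" using uv \<open>finite V\<close> by (intro card_Diff1_less) auto
    finally have "card (c' ` V) + card (insert e E) \<le> card V" using c(1) insert.hyps by simp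
    moreover have "(x, y) \<in> ?W (insert e E)" if "x \<in> V" "y \<in> V" "c' x = c' y" for x y
    proof -
      have sub: "?W E \<subseteq> ?W (insert e E)" by (rule mono) auto
      have uv': "(u, v) \<in> ?W (insert e E)" "(v, u) \<in> ?W (insert e E)" using e by auto
      from that(3) consider "c x = c y" | "c x = c v" "c u = c y" | "c x = c u" "c v = c y"
        by (auto simp: c'_def split: if_splits)
      then show ?thesis
        using c(2) that(1,2) uv sub uv' by cases (meson rtrancl_trans subsetD)+
    qed
    ultimately show ?case by blast
  qed
  then show ?thesis by auto
qed

text \<open>Symmetric, so that undirected walks of length \<open>m\<close> are the relational power
  \<open>^^ m\<close> and connectedness is the reflexive transitive closure.\<close>

definition bipartite_graph :: "('a \<times> 'a) set \<Rightarrow> (('a + 'a) \<times> ('a + 'a)) set" where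
  "bipartite_graph R = map_prod Inl Inr ` R \<union> (map_prod Inl Inr ` R)\<inverse>"

lemma bipartite_graph_iff [simp]:
  "(Inl a, Inr b) \<in> bipartite_graph R \<longleftrightarrow> (a, b) \<in> R"
  "(Inr b, Inl a) \<in> bipartite_graph R \<longleftrightarrow> (a, b) \<in> R"
  "(Inl a, Inl b) \<notin> bipartite_graph R"
  "(Inr a, Inr b) \<notin> bipartite_graph R"
  by (force simp: bipartite_graph_def)+

lemma isl_bipartite_graph: "(u, v) \<in> bipartite_graph R \<Longrightarrow> isl v \<longleftrightarrow> \<not> isl u"
  by (cases u; cases v) auto

lemma isl_bipartite_walk:
  "(Inl a, z) \<in> bipartite_graph R ^^ n \<Longrightarrow> isl z \<longleftrightarrow> even n"
  by (induction n arbitrary: z) (auto dest: isl_bipartite_graph)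

text \<open>A cycle through a constraint \<open>(x, y)\<close> would give a path from
  \<open>x\<close> to \<open>y\<close> in the other constraints. The witness for
  \<open>(x, y)\<close> maps it to a walk in \<open>R\<close> joining the ends of an edge of
  \<open>S - R\<close>. So the constraints form a forest on two copies of \<open>X\<close>, whence
  the factor 2.\<close>

lemma NRD_le_linear:
  assumes "\<And>a b. (a, b) \<in> S - R \<Longrightarrow> (Inl a, Inr b) \<notin> (bipartite_graph R)\<^sup>*"
  shows "NRD D R S n \<le> 2 * n"
proof -
  obtain X :: "nat set" and Y
    where XY: "card X = n" "nonredundant_instance D R S X Y" "card Y = NRD D R S n"
    by (rule NRD_attained)
  have X: "finite X" "Y \<subseteq> X \<times> X" using XY by (auto simp: nonredundant_instance_def)
  then have "finite Y" by (meson finite_SigmaI finite_subset)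
  let ?E = "map_prod Inl Inr ` Y :: ((nat + nat) \<times> (nat + nat)) set"
  have "card ?E \<le> card (X <+> X)"
  proof (rule card_forest_le)
    show "finite (X <+> X)" "finite ?E" "?E \<subseteq> (X <+> X) \<times> (X <+> X)"
      using X \<open>finite Y\<close> by auto
    fix u v :: "nat + nat" assume "(u, v) \<in> ?E"
    then obtain x y where uv: "u = Inl x" "v = Inr y" and xy: "(x, y) \<in> Y" by auto
    then obtain \<sigma> where \<sigma>: "\<And>y'. y' \<in> Y - {(x, y)} \<Longrightarrow> map_prod \<sigma> \<sigma> y' \<in> R" "(\<sigma> x, \<sigma> y) \<in> S - R"
      using XY(2) unfolding nonredundant_instance_def by (metis map_prod_simp)
    have "(map_sum \<sigma> \<sigma> a, map_sum \<sigma> \<sigma> b) \<in> (bipartite_graph R)\<^sup>*"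
      if "(a, b) \<in> (bipartite_graph (Y - {(x, y)}))\<^sup>*" for a b
      using that
    proof induction
      case base
      then show ?case by simp
    next
      case (step b c)
      from step(2) have "(map_sum \<sigma> \<sigma> b, map_sum \<sigma> \<sigma> c) \<in> bipartite_graph R"
        using \<sigma>(1) by (cases b; cases c) fastforce+
      with step.IH show ?case by (rule rtrancl_into_rtrancl)
    qed
    from this[of u v] have "(u, v) \<notin> (bipartite_graph (Y - {(x, y)}))\<^sup>*"
      using assms[OF \<sigma>(2)] uv by auto
    moreover have "?E - {(u, v)} = map_prod Inl Inr ` (Y - {(x, y)})" using uv by auto
    ultimately show "(u, v) \<notin> ((?E - {(u, v)}) \<union> (?E - {(u, v)})\<inverse>)\<^sup>*"
      by (simp add: bipartite_graph_def)
  qed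
  moreover have "card ?E = card Y" by (intro card_image inj_onI) auto
  ultimately show ?thesis using XY X by (simp add: card_Plus)
qed

section \<open>Maps to and from the cycle\<close>

(* The i-th vertex of the path C*_{2k}, which starts at the left copy of 0, ends at the right copy
   of 0 and alternates between the copies, is a copy of min i (2k - 1 - i). *)
lemma path_edge_in_C2_star:
  fixes p q :: nat
  assumes "2 \<le> k" "q = Suc p \<or> p = Suc q" "p \<le> 2 * k - 1" "q \<le> 2 * k - 1"
  shows "(min p (2 * k - 1 - p), min q (2 * k - 1 - q)) \<in> C2_star k"
  using assms by (auto simp: C2_star_def C2_def min_def)

text \<open>An edge of \<open>R\<close> changes the capped distance by exactly one: by at most one
  as walks extend, and not by zero because of parity. So it lands on an edge of the path, while
  \<open>a\<close> and \<open>b\<close> land on its two ends, which the missing edge joins.\<close>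

lemma fold_onto_cycle:
  assumes "2 \<le> k" and no_walk: "\<And>m. m < 2 * k - 1 \<Longrightarrow> (Inl a, Inr b) \<notin> bipartite_graph R ^^ m"
  shows "\<exists>f\<in>D \<rightarrow> {..<k}. \<exists>g\<in>D \<rightarrow> {..<k}.
    (\<forall>(x, y)\<in>R. (f x, g y) \<in> C2_star k) \<and> (f a, g b) \<in> C2 k - C2_star k"
proof -
  (* Since no parity is missing from length 2k - 2 on, this is the distance from a, capped at
     2k - 2 on the left and at 2k - 1 on the right. *)
  define P where
    "P z m \<longleftrightarrow> (Inl a, z) \<in> bipartite_graph R ^^ m \<or> 2 * k - 2 \<le> m \<and> (isl z \<longleftrightarrow> even m)" for z m
  define pos where "pos z = (LEAST m. P z m)" for z
  have "P z (if isl z then 2 * k - 2 else 2 * k - 1)" for z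
    using \<open>2 \<le> k\<close> by (auto simp: P_def)
  then have P_pos: "P z (pos z)"
    and pos_le': "pos z \<le> (if isl z then 2 * k - 2 else 2 * k - 1)" for z
    unfolding pos_def by (blast intro: LeastI Least_le)+
  have pos_le: "pos z \<le> 2 * k - 1" for z using pos_le'[of z] by (auto split: if_splits)
  have parity: "isl z \<longleftrightarrow> even (pos z)" for z
    using P_pos[of z] isl_bipartite_walk[of a z "pos z" R] by (auto simp: P_def)
  have step: "pos v \<le> Suc (pos u)" if "(u, v) \<in> bipartite_graph R" for u v
  proof -
    \<comment> \<open>Either the walk to \<open>u\<close> is extended by the edge, or the cap
      applies and the parity flips together with the side.\<close>
    have "P v (Suc (pos u))"
      using P_pos[of u] that isl_bipartite_graph[OF that] by (auto simp: P_def)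
    then show ?thesis unfolding pos_def by (rule Least_le)
  qed
  have pos_a: "pos (Inl a) = 0"
  proof -
    have "P (Inl a) 0" by (simp add: P_def)
    then show ?thesis unfolding pos_def by simp
  qed
  have pos_b: "pos (Inr b) = 2 * k - 1"
  proof (rule ccontr)
    assume "pos (Inr b) \<noteq> 2 * k - 1"
    then have less: "pos (Inr b) < 2 * k - 1" using pos_le[of "Inr b"] by simp
    \<comment> \<open>A right vertex has odd position, which rules out \<open>2 * k - 2\<close>;
      what remains is an actual walk, too short for \<open>no_walk\<close>.\<close>
    then have "\<not> (2 * k - 2 \<le> pos (Inr b))"
      using parity[of "Inr b"] by (cases "pos (Inr b) = 2 * k - 2") auto
    then show False using P_pos[of "Inr b"] no_walk[OF less] by (simp add: P_def)
  qed
  define \<phi> where "\<phi> z = min (pos z) (2 * k - 1 - pos z)" for z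
  have \<phi>_lt: "\<phi> z < k" for z using \<open>2 \<le> k\<close> by (auto simp: \<phi>_def min_def)
  have "(\<phi> (Inl x), \<phi> (Inr y)) \<in> C2_star k" if "(x, y) \<in> R" for x y
  proof -
    have "pos (Inl x) \<noteq> pos (Inr y)" using parity[of "Inl x"] parity[of "Inr y"] by auto
    moreover have "pos (Inl x) \<le> Suc (pos (Inr y))" "pos (Inr y) \<le> Suc (pos (Inl x))"
      using that by (auto intro: step)
    ultimately show ?thesis unfolding \<phi>_def
      using \<open>2 \<le> k\<close> pos_le by (intro path_edge_in_C2_star) auto
  qed
  moreover have "(\<phi> (Inl a), \<phi> (Inr b)) \<in> C2 k - C2_star k"
    using \<open>2 \<le> k\<close> by (auto simp: \<phi>_def pos_a pos_b C2_star_def C2_def)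
  ultimately show ?thesis using \<phi>_lt
    by (intro bexI[of _ "\<lambda>x. \<phi> (Inl x)"] bexI[of _ "\<lambda>x. \<phi> (Inr x)"]) auto
qed

text \<open>The path is laid along the walk: its \<open>i\<close>-th vertex goes to the
  \<open>i\<close>-th vertex of the walk, and sides agree by parity.\<close>

lemma cycle_into_relation:
  assumes "2 \<le> k" "R \<subseteq> D \<times> D" and walk: "(Inl a, Inr b) \<in> bipartite_graph R ^^ (2 * k - 1)"
  shows "\<exists>f\<in>{..<k} \<rightarrow> D. \<exists>g\<in>{..<k} \<rightarrow> D.
    (\<forall>(x, y)\<in>C2_star k. (f x, g y) \<in> R) \<and> f 0 = a \<and> g 0 = b"
proof -
  obtain v where v: "v 0 = Inl a" "v (2 * k - 1) = Inr b"
    "\<And>i. i < 2 * k - 1 \<Longrightarrow> (v i, v (Suc i)) \<in> bipartite_graph R"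
    using walk unfolding relpow_fun_conv by blast
  have isl: "isl (v i) \<longleftrightarrow> even i" if "i \<le> 2 * k - 1" for i
    using that
  proof (induction i)
    case (Suc i)
    then show ?case using isl_bipartite_graph[OF v(3)[of i]] by simp
  qed (simp add: v(1))
  have edge: "(projl (v p), projr (v q)) \<in> R"
    if "q = Suc p \<or> p = Suc q" "p \<le> 2 * k - 1" "q \<le> 2 * k - 1" "even p" for p q
  proof -
    have "isl (v p)" "\<not> isl (v q)" using isl that by auto
    then obtain x y where xy: "v p = Inl x" "v q = Inr y" by (metis isl_def sum.collapse(2))
    show ?thesis using that(1)
    proof
      assume "q = Suc p"
      then show ?thesis using v(3)[of p] that xy by auto
    next
      assume "p = Suc q"
      then show ?thesis using v(3)[of q] that xy by auto
    qed
  qed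
  \<comment> \<open>The number \<open>i\<close> names the path vertices at positions
    \<open>i\<close> and \<open>2 * k - 1 - i\<close>. These have opposite parity; the even one is
    the left copy, the odd one the right copy.\<close>
  define f where "f i = projl (v (if even i then i else 2 * k - 1 - i))" for i
  define g where "g i = projr (v (if odd i then i else 2 * k - 1 - i))" for i
  have "f i \<in> D" if "i < k" for i
  proof -
    define p where "p = (if even i then i else 2 * k - 1 - i)"
    have p: "even p" "p < 2 * k - 1" using that \<open>2 \<le> k\<close> by (auto simp: p_def elim!: oddE)
    then have "(projl (v p), projr (v (Suc p))) \<in> R" by (intro edge) auto
    then have "projl (v p) \<in> D" using \<open>R \<subseteq> D \<times> D\<close> by blast
    then show ?thesis by (simp add: f_def p_def)
  qed
  moreover have "g i \<in> D" if "i < k" for i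
  proof -
    define q where "q = (if odd i then i else 2 * k - 1 - i)"
    have q: "odd q" "q \<le> 2 * k - 1" using that \<open>2 \<le> k\<close> by (auto simp: q_def)
    then obtain p where "even p" "q = Suc p" by (cases q) auto
    then have "(projl (v p), projr (v q)) \<in> R" using q by (intro edge) auto
    then have "projr (v q) \<in> D" using \<open>R \<subseteq> D \<times> D\<close> by blast
    then show ?thesis by (simp add: g_def q_def)
  qed
  moreover have "(f x, g y) \<in> R" if "(x, y) \<in> C2_star k" for x y
  proof -
    \<comment> \<open>The pair \<open>(k - 1, k - 1)\<close> is the middle edge of the path, between
      positions \<open>k - 1\<close> and \<open>k\<close>.\<close>
    have *: "x < k" "y < k" "x = k - 1 \<and> y = k - 1 \<or> x = Suc y \<or> y = Suc x"
      using that by (auto simp: C2_star_def C2_def)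
    then show ?thesis unfolding f_def g_def by (intro edge) auto
  qed
  moreover have "f 0 = a" "g 0 = b" using v by (auto simp: f_def g_def)
  ultimately show ?thesis by (intro bexI[of _ f] bexI[of _ g]) auto
qed

section \<open>The dichotomy\<close>

theorem theorem4p7:
  fixes D :: "'d set"
  assumes "finite D"
  shows "\<exists>c1 > (0::real). \<exists>c2 > (0::real). \<exists>N :: nat.
    \<forall>R S. R \<subset> S \<and> S \<subseteq> D \<times> D \<longrightarrow>
      (\<forall>n\<ge>N. real (NRD D R S n) \<le> c2 * real n) \<or>
      (\<exists>k\<ge>2. \<forall>n\<ge>N.
         c1 * real (NRD {..<k} (C2_star k) (C2 k) n) \<le> real (NRD D R S n) \<and>
         real (NRD D R S n) \<le> c2 * real (NRD {..<k} (C2_star k) (C2 k) n))"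
proof -
  \<comment> \<open>The constant 7 and the threshold 2 are uniform in \<open>R\<close> and
    \<open>S\<close>, as the order of quantifiers demands.\<close>
  have dichotomy: "(\<forall>n\<ge>2. NRD D R S n \<le> 7 * n) \<or>
      (\<exists>k\<ge>2. \<forall>n\<ge>2. NRD {..<k} (C2_star k) (C2 k) n \<le> 7 * NRD D R S n \<and>
         NRD D R S n \<le> 7 * NRD {..<k} (C2_star k) (C2 k) n)"
    if RS: "R \<subset> S" "S \<subseteq> D \<times> D" for R S
  proof (cases "\<exists>m. \<exists>(a, b)\<in>S - R. (Inl a, Inr b) \<in> bipartite_graph R ^^ m")
    case False
    then have "NRD D R S n \<le> 2 * n" for n
      by (intro NRD_le_linear) (auto simp: rtrancl_power)
    then have "NRD D R S n \<le> 7 * n" for n by (rule order_trans) simp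
    then show ?thesis by blast
  next
    case True
    \<comment> \<open>The minimum is over all edges of \<open>S - R\<close> together: one edge
      attains it, which gives the maps from the cycle, and none has a shorter walk, which lets every
      edge be folded.\<close>
    define l where "l = (LEAST m. \<exists>(a, b)\<in>S - R. (Inl a, Inr b) \<in> bipartite_graph R ^^ m)"
    obtain a b where ab: "(a, b) \<in> S - R" "(Inl a, Inr b) \<in> bipartite_graph R ^^ l"
      using LeastI_ex[OF True] unfolding l_def by blast
    have least: "(Inl a', Inr b') \<notin> bipartite_graph R ^^ m" if "(a', b') \<in> S - R" "m < l" for a' b' m
      using not_less_Least[OF that(2)[unfolded l_def]] that(1) by blast
    have "odd l" using isl_bipartite_walk[OF ab(2)] by simp
    \<comment> \<open>A walk of length 1 would put \<open>(a, b)\<close> into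
      \<open>R\<close>.\<close>
    moreover have "l \<noteq> 1" using ab by auto
    ultimately obtain j where j: "l = 2 * j + 1" "j \<noteq> 0" by (auto elim: oddE)
    define k where "k = Suc j"
    have k: "2 \<le> k" "l = 2 * k - 1" using j by (auto simp: k_def)
    have "R \<noteq> {}"
    proof
      assume "R = {}"
      then have "bipartite_graph R ^^ l = {}"
        using \<open>odd l\<close> by (cases l) (auto simp: bipartite_graph_def)
      then show False using ab by simp
    qed
    have "(0, 0) \<in> C2 k" using k(1) by (simp add: C2_def)
    moreover have "C2 k \<subseteq> {..<k} \<times> {..<k}" by (auto simp: C2_def)
    moreover have "(0, 1) \<in> C2_star k" using k(1) by (simp add: C2_star_def C2_def)
    ultimately have C2: "C2_star k \<noteq> {}" "C2_star k \<subset> C2 k" "C2 k \<subseteq> {..<k} \<times> {..<k}"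
      by (auto simp: C2_star_def)
    have "NRD {..<k} (C2_star k) (C2 k) n \<le> 7 * NRD D R S n" if "2 \<le> n" for n
    proof (rule NRD_le_if_maps[OF that \<open>R \<noteq> {}\<close> RS])
      \<comment> \<open>The only missing edge is \<open>(0, 0)\<close>, so the single minimizing
        pair \<open>(a, b)\<close> suffices.\<close>
      fix x y assume "(x, y) \<in> C2 k - C2_star k"
      then have "x = 0" "y = 0" by (auto simp: C2_star_def)
      then show "\<exists>f\<in>{..<k} \<rightarrow> D. \<exists>g\<in>{..<k} \<rightarrow> D.
          (\<forall>(x, y)\<in>C2_star k. (f x, g y) \<in> R) \<and> (f x, g y) \<in> S - R"
        using cycle_into_relation[of k R D a b] k RS ab by blast
    qed
    moreover have "NRD D R S n \<le> 7 * NRD {..<k} (C2_star k) (C2 k) n" if "2 \<le> n" for n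
      using least k by (intro NRD_le_if_maps[OF that C2] fold_onto_cycle) auto
    ultimately show ?thesis using k(1) by blast
  qed
  show ?thesis
  proof (rule exI[of _ "1/7"], rule conjI, simp, rule exI[of _ 7], rule conjI, simp,
      rule exI[of _ 2], intro allI impI)
    fix R S assume "R \<subset> S \<and> S \<subseteq> D \<times> D"
    then have "(\<forall>n\<ge>2. NRD D R S n \<le> 7 * n) \<or>
      (\<exists>k\<ge>2. \<forall>n\<ge>2. NRD {..<k} (C2_star k) (C2 k) n \<le> 7 * NRD D R S n \<and>
         NRD D R S n \<le> 7 * NRD {..<k} (C2_star k) (C2 k) n)"
      by (intro dichotomy) auto
    moreover have "1 / 7 * real i \<le> real j \<longleftrightarrow> i \<le> 7 * j" "real i \<le> 7 * real j \<longleftrightarrow> i \<le> 7 * j"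
      for i j by linarith+
    ultimately show "(\<forall>n\<ge>2. real (NRD D R S n) \<le> 7 * real n) \<or>
      (\<exists>k\<ge>2. \<forall>n\<ge>2.
         1 / 7 * real (NRD {..<k} (C2_star k) (C2 k) n) \<le> real (NRD D R S n) \<and>
         real (NRD D R S n) \<le> 7 * real (NRD {..<k} (C2_star k) (C2 k) n))"
      by simp
  qed
qed

end
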